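(* For every integer $k\ge 1$, the logic $\mathrm{Log}\,\mathcal D_k$ has the Lyndon positivity property (LPP), where $\mathcal D_k$ is the Kripke frame with set of worlds $\{0,1,\dots,k\}$ and accessibility relation $\bigl(\{0,\dots,k-1\}\times\{0,\dots,k-1\}\bigr)\cup\bigl(\{k\}\times\{0,1,\dots,k\}\bigr)$.
   Context: Formulas. Fix a countably infinite set $\mathcal V$ of propositional variables. A literal is a variable $p$ or its negation $\neg p$. Modal formulas are built from literals and $\bot,\top$ using $\wedge,\vee,\Diamond,\Box$; negation of an arbitrary formula is defined by the duality laws, and $\varphi\to\psi$ is $\neg\varphi\vee\psi$. $\mathrm{lits}(\varphi)$ is the set of literals occurring in $\varphi$. $\varphi(\vec p,\bar r)$ means that all variables of $\varphi$ are among $\vec p,\bar r$; substitution is simultaneous with negations expanded. Logics. A modal logic is a set $\Lambda$ of formulas containing all classical tautologies and closed under modus ponens, uniform substitution and the rule: from $\varphi\leftrightarrow\psi$ infer $\Diamond\varphi\leftrightarrow\Diamond\psi$. $\Lambda\vdash\varphi$ means $\varphi\in\Lambda$. $\Lambda$ is monotone if it contains $\Diamond p\to\Diamond(p\vee q)$. $\mathrm{Log}\,\mathcal F$ is the set of formulas valid in the Kripke frame $\mathcal F$ under the usual Kripke semantics; it is a monotone modal logic. LPP. Let $\vec p=(p_i)_{i<n}$, $\bar r=(r_j)_{j<m}$ be finite tuples of pairwise distinct variables. A formula $\varphi(\vec p,\bar r)$ is $\vec p$-positive if no $\neg p_i$ is in $\mathrm{lits}(\varphi)$. It is $\vec p$-monotone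 in $\Lambda$ if $\Lambda\vdash\varphi(\vec p,\bar r)\to\varphi(\vec p\vee\vec q,\bar r)$, where $\vec q=(q_i)_{i<n}$ is a tuple of fresh distinct variables and $\vec p\vee\vec q=(p_i\vee q_i)_{i<n}$. A monotone logic $\Lambda$ has LPP if for all such $\vec p,\bar r$, every formula $\varphi(\vec p,\bar r)$ that is $\vec p$-monotone in $\Lambda$ is $\Lambda$-equivalent (i.e. $\Lambda\vdash\varphi\leftrightarrow\alpha$) to some $\vec p$-positive formula $\alpha(\vec p,\bar r)$. *)

theory Defs
  imports Main
begin

text \<open>Modal formulas in negation normal form over the propositional variables \<open>nat\<close>.
  Only literals carry a negation; \<open>neg\<close> is an operation on formulas.\<close>

datatype fm =
    Pos nat
  | Neg nat
  | Bot
  | Top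
  | And fm fm
  | Or fm fm
  | Dia fm
  | Box fm

primrec neg :: "fm \<Rightarrow> fm" where
  "neg (Pos p) = Neg p"
| "neg (Neg p) = Pos p"
| "neg Bot = Top"
| "neg Top = Bot"
| "neg (And \<phi> \<psi>) = Or (neg \<phi>) (neg \<psi>)"
| "neg (Or \<phi> \<psi>) = And (neg \<phi>) (neg \<psi>)"
| "neg (Dia \<phi>) = Box (neg \<phi>)"
| "neg (Box \<phi>) = Dia (neg \<phi>)"

definition Imp :: "fm \<Rightarrow> fm \<Rightarrow> fm" where
  "Imp \<phi> \<psi> = Or (neg \<phi>) \<psi>"

definition Iff :: "fm \<Rightarrow> fm \<Rightarrow> fm" where
  "Iff \<phi> \<psi> = And (Imp \<phi> \<psi>) (Imp \<psi> \<phi>)"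

text \<open>Literals are represented by the formulas \<open>Pos p\<close> and \<open>Neg p\<close> themselves.\<close>

primrec lits :: "fm \<Rightarrow> fm set" where
  "lits (Pos p) = {Pos p}"
| "lits (Neg p) = {Neg p}"
| "lits Bot = {}"
| "lits Top = {}"
| "lits (And \<phi> \<psi>) = lits \<phi> \<union> lits \<psi>"
| "lits (Or \<phi> \<psi>) = lits \<phi> \<union> lits \<psi>"
| "lits (Dia \<phi>) = lits \<phi>"
| "lits (Box \<phi>) = lits \<phi>"

definition vars :: "fm \<Rightarrow> nat set" where
  "vars \<phi> = {p. Pos p \<in> lits \<phi> \<or> Neg p \<in> lits \<phi>}"

primrec subst :: "(nat \<Rightarrow> fm) \<Rightarrow> fm \<Rightarrow> fm" where
  "subst \<sigma> (Pos p) = \<sigma> p"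
| "subst \<sigma> (Neg p) = neg (\<sigma> p)"
| "subst \<sigma> Bot = Bot"
| "subst \<sigma> Top = Top"
| "subst \<sigma> (And \<phi> \<psi>) = And (subst \<sigma> \<phi>) (subst \<sigma> \<psi>)"
| "subst \<sigma> (Or \<phi> \<psi>) = Or (subst \<sigma> \<phi>) (subst \<sigma> \<psi>)"
| "subst \<sigma> (Dia \<phi>) = Dia (subst \<sigma> \<phi>)"
| "subst \<sigma> (Box \<phi>) = Box (subst \<sigma> \<phi>)"

text \<open>Classical tautologies are modality-free formulas true under all Boolean valuations; their
  modal instances belong to a modal logic by closure under substitution. The values of
  \<open>beval\<close> on modal formulas are irrelevant.\<close>

primrec modality_free :: "fm \<Rightarrow> bool" where
  "modality_free (Pos p) \<longleftrightarrow> True"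
| "modality_free (Neg p) \<longleftrightarrow> True"
| "modality_free Bot \<longleftrightarrow> True"
| "modality_free Top \<longleftrightarrow> True"
| "modality_free (And \<phi> \<psi>) \<longleftrightarrow> modality_free \<phi> \<and> modality_free \<psi>"
| "modality_free (Or \<phi> \<psi>) \<longleftrightarrow> modality_free \<phi> \<and> modality_free \<psi>"
| "modality_free (Dia \<phi>) \<longleftrightarrow> False"
| "modality_free (Box \<phi>) \<longleftrightarrow> False"

primrec beval :: "(nat \<Rightarrow> bool) \<Rightarrow> fm \<Rightarrow> bool" where
  "beval v (Pos p) \<longleftrightarrow> v p"
| "beval v (Neg p) \<longleftrightarrow> \<not> v p"
| "beval v Bot \<longleftrightarrow> False"
| "beval v Top \<longleftrightarrow> True"
| "beval v (And \<phi> \<psi>) \<longleftrightarrow> beval v \<phi> \<and> beval v \<psi>"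
| "beval v (Or \<phi> \<psi>) \<longleftrightarrow> beval v \<phi> \<or> beval v \<psi>"
| "beval v (Dia \<phi>) \<longleftrightarrow> False"
| "beval v (Box \<phi>) \<longleftrightarrow> False"

definition tautology :: "fm \<Rightarrow> bool" where
  "tautology \<phi> \<longleftrightarrow> modality_free \<phi> \<and> (\<forall>v. beval v \<phi>)"

definition modal_logic :: "fm set \<Rightarrow> bool" where
  "modal_logic \<Lambda> \<longleftrightarrow>
     (\<forall>\<phi>. tautology \<phi> \<longrightarrow> \<phi> \<in> \<Lambda>) \<and>
     (\<forall>\<phi> \<psi>. \<phi> \<in> \<Lambda> \<and> Imp \<phi> \<psi> \<in> \<Lambda> \<longrightarrow> \<psi> \<in> \<Lambda>) \<and>
     (\<forall>\<phi> \<sigma>. \<phi> \<in> \<Lambda> \<longrightarrow> subst \<sigma> \<phi> \<in> \<Lambda>) \<and>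
     (\<forall>\<phi> \<psi>. Iff \<phi> \<psi> \<in> \<Lambda> \<longrightarrow> Iff (Dia \<phi>) (Dia \<psi>) \<in> \<Lambda>)"

text \<open>The variables \<open>0\<close> and \<open>1\<close> play the roles of \<open>p\<close> and \<open>q\<close> in the axiom
  \<open>\<diamond>p \<longrightarrow> \<diamond>(p \<or> q)\<close>.\<close>

definition monotone_logic :: "fm set \<Rightarrow> bool" where
  "monotone_logic \<Lambda> \<longleftrightarrow>
     modal_logic \<Lambda> \<and> Imp (Dia (Pos 0)) (Dia (Or (Pos 0) (Pos 1))) \<in> \<Lambda>"

record 'w frame =
  worlds :: "'w set"
  acc :: "('w \<times> 'w) set"

primrec sat :: "'w frame \<Rightarrow> (nat \<Rightarrow> 'w set) \<Rightarrow> 'w \<Rightarrow> fm \<Rightarrow> bool" where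
  "sat F V w (Pos p) \<longleftrightarrow> w \<in> V p"
| "sat F V w (Neg p) \<longleftrightarrow> w \<notin> V p"
| "sat F V w Bot \<longleftrightarrow> False"
| "sat F V w Top \<longleftrightarrow> True"
| "sat F V w (And \<phi> \<psi>) \<longleftrightarrow> sat F V w \<phi> \<and> sat F V w \<psi>"
| "sat F V w (Or \<phi> \<psi>) \<longleftrightarrow> sat F V w \<phi> \<or> sat F V w \<psi>"
| "sat F V w (Dia \<phi>) \<longleftrightarrow> (\<exists>u\<in>worlds F. (w, u) \<in> acc F \<and> sat F V u \<phi>)"
| "sat F V w (Box \<phi>) \<longleftrightarrow> (\<forall>u\<in>worlds F. (w, u) \<in> acc F \<longrightarrow> sat F V u \<phi>)"

text \<open>Valuations need not be confined to \<open>worlds F\<close>: satisfaction at a world of \<open>F\<close> depends only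
  on the restriction of \<open>V\<close> to \<open>worlds F\<close>.\<close>

definition Log :: "'w frame \<Rightarrow> fm set" where
  "Log F = {\<phi>. \<forall>V. \<forall>w\<in>worlds F. sat F V w \<phi>}"

definition positive_in :: "nat list \<Rightarrow> fm \<Rightarrow> bool" where
  "positive_in ps \<phi> \<longleftrightarrow> (\<forall>p\<in>set ps. Neg p \<notin> lits \<phi>)"

text \<open>The substitution replacing each \<open>ps ! i\<close> by \<open>ps ! i \<or> qs ! i\<close> and fixing all
  other variables.\<close>

definition join_subst :: "nat list \<Rightarrow> nat list \<Rightarrow> nat \<Rightarrow> fm" where
  "join_subst ps qs x =
     (case map_of (zip ps qs) x of None \<Rightarrow> Pos x | Some q \<Rightarrow> Or (Pos x) (Pos q))"

text \<open>In a logic closed under substitution the choice of the fresh tuple \<open>qs\<close> is immaterial.\<close>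

definition monotone_in :: "fm set \<Rightarrow> nat list \<Rightarrow> nat list \<Rightarrow> fm \<Rightarrow> bool" where
  "monotone_in \<Lambda> ps rs \<phi> \<longleftrightarrow>
     (\<exists>qs. length qs = length ps \<and> distinct qs \<and> set qs \<inter> (set ps \<union> set rs) = {} \<and>
           Imp \<phi> (subst (join_subst ps qs) \<phi>) \<in> \<Lambda>)"

text \<open>The property is only defined for monotone logics, so monotonicity is made part of it.\<close>

definition LPP :: "fm set \<Rightarrow> bool" where
  "LPP \<Lambda> \<longleftrightarrow>
     monotone_logic \<Lambda> \<and>
     (\<forall>ps rs \<phi>. distinct (ps @ rs) \<and> vars \<phi> \<subseteq> set ps \<union> set rs \<and> monotone_in \<Lambda> ps rs \<phi> \<longrightarrow>
        (\<exists>\<alpha>. vars \<alpha> \<subseteq> set ps \<union> set rs \<and> positive_in ps \<alpha> \<and> Iff \<phi> \<alpha> \<in> \<Lambda>))"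

definition D_frame :: "nat \<Rightarrow> nat frame" where
  "D_frame k = \<lparr>worlds = {0..k}, acc = ({0..<k} \<times> {0..<k}) \<union> ({k} \<times> {0..k})\<rparr>"

end

theory Submission
  imports Defs
begin

text \<open>
  Every world of \<open>D_frame k\<close> sees itself, the cluster \<open>{..<k}\<close>, and nothing else. Call the set
  of those variables from \<open>ps\<close> and \<open>rs\<close> that are true at a world the type of that world. The
  truth of \<open>\<phi>\<close> at \<open>w\<close> then depends only on the pair \<open>(t, T)\<close> of the type \<open>t\<close>
  of \<open>w\<close> and the set \<open>T\<close> of types of cluster worlds (\<open>sat_D_frame_types\<close>): a modality either
  returns to \<open>w\<close> or enters the cluster, where only \<open>T\<close> matters.

  Order types by \<open>t \<le> t'\<close> if \<open>t'\<close> arises from \<open>t\<close> by adding variables from \<open>ps\<close>. Above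
  \<open>(t, T)\<close> lie the pairs \<open>(t', T')\<close> with \<open>t \<le> t'\<close> such that every member of \<open>T\<close> is below one
  of \<open>T'\<close> and every member of \<open>T'\<close> is above one of \<open>T\<close> (the Egli-Milner order).
  Lying above \<open>(t, T)\<close> is expressed by a positive formula: \<open>\<box>\<diamond>\<psi>\<close> says that \<open>\<psi>\<close> holds
  somewhere in the cluster, \<open>\<diamond>\<box>\<psi>\<close> that it holds everywhere in it (\<open>sat_types_fm\<close>). The
  positive equivalent of \<open>\<phi>\<close> is the disjunction of these formulas over the finitely many pairs at
  which \<open>\<phi>\<close> is true. It is implied by \<open>\<phi>\<close>, and it implies \<open>\<phi>\<close> as soon as truth of \<open>\<phi>\<close> is
  inherited upwards in this order on pairs (\<open>sat_types_egli_milner\<close>).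

  Monotonicity of \<open>\<phi>\<close> gives less at first: the valuation can be enlarged world by world
  (\<open>sat_types_mono\<close>), which moves \<open>T\<close> to \<open>T'\<close> only when the \<open>k\<close> cluster worlds enumerate \<open>T\<close>
  as \<open>f\<close> and \<open>T'\<close> as \<open>g\<close> with \<open>f i \<le> g i\<close> for all \<open>i < k\<close>. For Egli-Milner related
  \<open>T\<close> and \<open>T'\<close>, more than \<open>k\<close> pairs may be needed to relate all members. The remedy is
  to pass through an intermediate set \<open>T''\<close> onto which both map surjectively, \<open>T\<close> upwards and
  \<open>T'\<close> downwards (\<open>egli_milner_interpolation\<close>). An enumeration of \<open>T\<close> then carries the step from
  \<open>T\<close> to \<open>T''\<close>, and one of \<open>T'\<close> the step from \<open>T''\<close> to \<open>T'\<close>.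

  The two steps need no synchronisation with the world of evaluation because they are carried out
  at the root: the root may be given any type without affecting the cluster, and it satisfies the
  same formulas as a cluster world of the same type. Inside the cluster such a path need not exist,
  since the evaluation world would have to serve as one of the \<open>k\<close> enumerated worlds.
\<close>

section \<open>Logics of frames are monotone\<close>

lemma sat_neg: "sat F V w (neg \<phi>) \<longleftrightarrow> \<not> sat F V w \<phi>"
  by (induction \<phi> arbitrary: w) auto

lemma sat_Imp: "sat F V w (Imp \<phi> \<psi>) \<longleftrightarrow> (sat F V w \<phi> \<longrightarrow> sat F V w \<psi>)"
  by (auto simp: Imp_def sat_neg)

lemma sat_Iff: "sat F V w (Iff \<phi> \<psi>) \<longleftrightarrow> (sat F V w \<phi> \<longleftrightarrow> sat F V w \<psi>)"
  by (auto simp: Iff_def sat_Imp)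

lemma sat_subst: "sat F V w (subst \<sigma> \<phi>) \<longleftrightarrow> sat F (\<lambda>x. {u. sat F V u (\<sigma> x)}) w \<phi>"
  by (induction \<phi> arbitrary: w) (auto simp: sat_neg)

lemma sat_modality_free:
  "modality_free \<phi> \<Longrightarrow> sat F V w \<phi> \<longleftrightarrow> beval (\<lambda>x. w \<in> V x) \<phi>"
  by (induction \<phi>) auto

lemma monotone_logic_Log: "monotone_logic (Log F)"
  unfolding monotone_logic_def modal_logic_def
proof (intro conjI allI impI)
  fix \<phi> assume "tautology \<phi>"
  then show "\<phi> \<in> Log F"
    by (auto simp: tautology_def Log_def sat_modality_free)
next
  fix \<phi> \<psi> assume "\<phi> \<in> Log F \<and> Imp \<phi> \<psi> \<in> Log F"
  then show "\<psi> \<in> Log F"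
    by (auto simp: Log_def sat_Imp)
next
  fix \<phi> \<sigma> assume "\<phi> \<in> Log F"
  then show "subst \<sigma> \<phi> \<in> Log F"
    by (auto simp: Log_def sat_subst)
next
  fix \<phi> \<psi> assume "Iff \<phi> \<psi> \<in> Log F"
  then show "Iff (Dia \<phi>) (Dia \<psi>) \<in> Log F"
    by (auto simp: Log_def sat_Iff)
next
  show "Imp (Dia (Pos 0)) (Dia (Or (Pos 0) (Pos 1))) \<in> Log F"
    by (auto simp: Log_def sat_Imp)
qed

section \<open>Monotone formulas\<close>

lemma vars_simps [simp]:
  "vars (Pos p) = {p}" "vars (Neg p) = {p}" "vars Bot = {}" "vars Top = {}"
  "vars (And \<phi> \<psi>) = vars \<phi> \<union> vars \<psi>" "vars (Or \<phi> \<psi>) = vars \<phi> \<union> vars \<psi>"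
  "vars (Dia \<phi>) = vars \<phi>" "vars (Box \<phi>) = vars \<phi>"
  by (auto simp: vars_def)

lemma sat_cong_vars:
  "(\<And>x. x \<in> vars \<phi> \<Longrightarrow> V x = V' x) \<Longrightarrow> sat F V w \<phi> \<longleftrightarrow> sat F V' w \<phi>"
  by (induction \<phi> arbitrary: w) auto

text \<open>The semantic content of syntactic monotonicity: let the fresh \<open>qs\<close> take the values that
  the larger valuation gives to \<open>ps\<close>.\<close>

lemma monotone_in_sat_mono:
  assumes mono: "monotone_in (Log F) ps rs \<phi>"
    and vars: "vars \<phi> \<subseteq> set ps \<union> set rs" and dist: "distinct (ps @ rs)"
    and w: "w \<in> worlds F" and sat: "sat F V w \<phi>"
    and up: "\<And>p. p \<in> set ps \<Longrightarrow> V p \<subseteq> V' p" and eq: "\<And>r. r \<in> set rs \<Longrightarrow> V r = V' r"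
  shows "sat F V' w \<phi>"
proof -
  obtain qs where len: "length qs = length ps" and dq: "distinct qs"
    and fresh: "set qs \<inter> (set ps \<union> set rs) = {}"
    and valid: "Imp \<phi> (subst (join_subst ps qs) \<phi>) \<in> Log F"
    using mono by (auto simp: monotone_in_def)
  define U where "U x = (case map_of (zip qs ps) x of None \<Rightarrow> V x | Some p \<Rightarrow> V' p)" for x
  have U_old: "U x = V x" if "x \<in> set ps \<union> set rs" for x
  proof -
    have "map_of (zip qs ps) x = None"
      using that fresh len by (auto simp: map_of_eq_None_iff dest: set_zip_leftD)
    then show ?thesis by (simp add: U_def)
  qed
  have "sat F U w \<phi>"
    using sat sat_cong_vars[of \<phi> U V F w] U_old vars by blast
  then have "sat F U w (subst (join_subst ps qs) \<phi>)"
    using valid w by (auto simp: Log_def sat_Imp)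
  then have *: "sat F (\<lambda>x. {u. sat F U u (join_subst ps qs x)}) w \<phi>"
    by (simp add: sat_subst)
  have "{u. sat F U u (join_subst ps qs x)} = V' x" if "x \<in> vars \<phi>" for x
  proof (cases "x \<in> set ps")
    case True
    then obtain i where i: "i < length ps" "x = ps ! i" by (auto simp: in_set_conv_nth)
    have "map_of (zip ps qs) x = Some (qs ! i)"
      using i len dist by (auto simp: map_of_zip_nth)
    moreover have "map_of (zip qs ps) (qs ! i) = Some x"
      using i len dq by (auto simp: map_of_zip_nth)
    ultimately have "{u. sat F U u (join_subst ps qs x)} = V x \<union> V' x"
      using U_old True by (auto simp: join_subst_def U_def[of "qs ! i"])
    then show ?thesis using up[OF True] by auto
  next
    case False
    then have r: "x \<in> set rs" using that vars by auto
    have "map_of (zip ps qs) x = None"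
      using False len by (auto simp: map_of_eq_None_iff dest: set_zip_leftD)
    then show ?thesis using U_old r eq by (auto simp: join_subst_def)
  qed
  then have "sat F (\<lambda>x. {u. sat F U u (join_subst ps qs x)}) w \<phi> \<longleftrightarrow> sat F V' w \<phi>"
    by (rule sat_cong_vars)
  then show ?thesis using * by simp
qed

section \<open>Truth in \<open>D_frame k\<close> depends only on types\<close>

definition vtype :: "nat set \<Rightarrow> (nat \<Rightarrow> 'w set) \<Rightarrow> 'w \<Rightarrow> nat set" where
  "vtype Q V w = {x \<in> Q. w \<in> V x}"

definition cluster_types :: "nat \<Rightarrow> nat set \<Rightarrow> (nat \<Rightarrow> nat set) \<Rightarrow> nat set set" where
  "cluster_types k Q V = vtype Q V ` {..<k}"

lemma worlds_D_frame [simp]: "worlds (D_frame k) = {0..k}"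
  by (simp add: D_frame_def)

lemma acc_D_frame [simp]:
  "(w, u) \<in> acc (D_frame k) \<longleftrightarrow> w < k \<and> u < k \<or> w = k \<and> u \<le> k"
  by (auto simp: D_frame_def)

text \<open>Root and cluster worlds obey the same clause for the modalities, as the root sees no world
  outside the cluster but itself, and cluster worlds are reflexive.\<close>

lemma sat_D_Dia:
  assumes "w \<le> k"
  shows "sat (D_frame k) V w (Dia \<phi>) \<longleftrightarrow>
    sat (D_frame k) V w \<phi> \<or> (\<exists>u<k. sat (D_frame k) V u \<phi>)"
  using assms by (cases "w = k") (auto simp: le_less)

lemma sat_D_Box:
  assumes "w \<le> k"
  shows "sat (D_frame k) V w (Box \<phi>) \<longleftrightarrow>
    sat (D_frame k) V w \<phi> \<and> (\<forall>u<k. sat (D_frame k) V u \<phi>)"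
  using assms by (cases "w = k") (auto simp: le_less)

text \<open>The worlds \<open>w\<close> and \<open>w'\<close> may be of different kinds: a root that repeats a type of its
  cluster is indistinguishable from the cluster worlds of that type.\<close>

lemma sat_D_frame_types:
  assumes "vars \<phi> \<subseteq> Q" and "w \<le> k" and "w' \<le> k"
    and "vtype Q V w = vtype Q V' w'" and T: "cluster_types k Q V = cluster_types k Q V'"
  shows "sat (D_frame k) V w \<phi> \<longleftrightarrow> sat (D_frame k) V' w' \<phi>"
proof -
  have match: "\<exists>u'<k. vtype Q V u = vtype Q V' u'" if "u < k" for u
  proof -
    have "vtype Q V u \<in> vtype Q V' ` {..<k}"
      using T that by (auto simp: cluster_types_def)
    then show ?thesis by auto
  qed
  have match': "\<exists>u<k. vtype Q V u = vtype Q V' u'" if "u' < k" for u'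
  proof -
    have "vtype Q V' u' \<in> vtype Q V ` {..<k}"
      using T that by (auto simp: cluster_types_def)
    then show ?thesis by auto
  qed
  show ?thesis
    using assms(1-4)
  proof (induction \<phi> arbitrary: w w')
    case (Dia \<phi>)
    have "sat (D_frame k) V w \<phi> \<longleftrightarrow> sat (D_frame k) V' w' \<phi>"
      using Dia by simp
    moreover have "(\<exists>u<k. sat (D_frame k) V u \<phi>) \<longleftrightarrow> (\<exists>u<k. sat (D_frame k) V' u \<phi>)"
      using Dia.IH Dia.prems(1) match match' by (metis less_imp_le vars_simps(7))
    ultimately show ?case using Dia.prems by (simp only: sat_D_Dia)
  next
    case (Box \<phi>)
    have "sat (D_frame k) V w \<phi> \<longleftrightarrow> sat (D_frame k) V' w' \<phi>"
      using Box by simp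
    moreover have "(\<forall>u<k. sat (D_frame k) V u \<phi>) \<longleftrightarrow> (\<forall>u<k. sat (D_frame k) V' u \<phi>)"
      using Box.IH Box.prems(1) match match' by (metis less_imp_le vars_simps(8))
    ultimately show ?case using Box.prems by (simp only: sat_D_Box)
  qed (auto simp: vtype_def)
qed

definition sat_types :: "nat \<Rightarrow> nat set \<Rightarrow> fm \<Rightarrow> nat set \<Rightarrow> nat set set \<Rightarrow> bool" where
  "sat_types k Q \<phi> t T \<longleftrightarrow>
     (\<exists>V w. w \<le> k \<and> vtype Q V w = t \<and> cluster_types k Q V = T \<and> sat (D_frame k) V w \<phi>)"

lemma sat_types_vtype:
  assumes "vars \<phi> \<subseteq> Q" and "w \<le> k"
  shows "sat_types k Q \<phi> (vtype Q V w) (cluster_types k Q V) \<longleftrightarrow> sat (D_frame k) V w \<phi>"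
  using assms sat_D_frame_types unfolding sat_types_def by metis

text \<open>The valuation that gives the root type \<open>t\<close> and cluster world \<open>i\<close> type \<open>f i\<close>.\<close>

definition D_val :: "nat \<Rightarrow> nat set \<Rightarrow> (nat \<Rightarrow> nat set) \<Rightarrow> nat \<Rightarrow> nat set" where
  "D_val k t f x = {i. i < k \<and> x \<in> f i \<or> i = k \<and> x \<in> t}"

lemma vtype_D_val:
  "vtype Q (D_val k t f) k = t \<inter> Q" "i < k \<Longrightarrow> vtype Q (D_val k t f) i = f i \<inter> Q"
  by (auto simp: vtype_def D_val_def)

definition type_le :: "nat set \<Rightarrow> nat set \<Rightarrow> nat set \<Rightarrow> bool" where
  "type_le P t t' \<longleftrightarrow> t \<subseteq> t' \<and> t' - t \<subseteq> P"

lemma type_le_refl: "type_le P t t"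
  by (simp add: type_le_def)

text \<open>Evaluation takes place at the root, so that the change from \<open>t\<close> to \<open>t'\<close> is
  independent of the changes from \<open>f i\<close> to \<open>g i\<close>, even if \<open>t\<close> is realised in the
  cluster.\<close>

lemma sat_types_mono:
  assumes mono: "monotone_in (Log (D_frame k)) ps rs \<phi>"
    and vars: "vars \<phi> \<subseteq> set ps \<union> set rs" and dist: "distinct (ps @ rs)"
    and Q: "Q = set ps \<union> set rs"
    and t: "type_le (set ps) t t'" "t' \<subseteq> Q"
    and f: "\<And>i. i < k \<Longrightarrow> type_le (set ps) (f i) (g i) \<and> g i \<subseteq> Q"
    and sat: "sat_types k Q \<phi> t (f ` {..<k})"
  shows "sat_types k Q \<phi> t' (g ` {..<k})"
proof -
  have tQ: "t \<subseteq> Q" using t by (auto simp: type_le_def)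
  have fQ: "f i \<subseteq> Q" if "i < k" for i
    using f[OF that] by (auto simp: type_le_def)
  let ?V = "D_val k t f" and ?V' = "D_val k t' g"
  have V: "vtype Q ?V k = t" "cluster_types k Q ?V = f ` {..<k}"
    using tQ fQ by (auto simp: cluster_types_def vtype_D_val Int_absorb2 intro!: image_cong)
  have V': "vtype Q ?V' k = t'" "cluster_types k Q ?V' = g ` {..<k}"
    using t f by (auto simp: cluster_types_def vtype_D_val Int_absorb2 intro!: image_cong)
  have "sat (D_frame k) ?V k \<phi>"
    using sat sat_types_vtype[of \<phi> Q k k ?V] vars Q V by simp
  moreover have "?V p \<subseteq> ?V' p" for p
    using t f by (auto simp: D_val_def type_le_def subset_iff)
  moreover have "?V r = ?V' r" if "r \<in> set rs" for r
  proof -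
    have "r \<notin> set ps" using that dist by auto
    then show ?thesis using t f by (auto simp: D_val_def type_le_def subset_iff)
  qed
  ultimately have "sat (D_frame k) ?V' k \<phi>"
    using monotone_in_sat_mono[OF mono vars dist, of k ?V ?V'] by simp
  then show ?thesis
    using sat_types_vtype[of \<phi> Q k k ?V'] vars Q V' by simp
qed

section \<open>Interpolating between related sets of types\<close>

definition egli_milner :: "('a \<Rightarrow> 'b \<Rightarrow> bool) \<Rightarrow> 'a set \<Rightarrow> 'b set \<Rightarrow> bool" where
  "egli_milner R A B \<longleftrightarrow> (\<forall>a\<in>A. \<exists>b\<in>B. R a b) \<and> (\<forall>b\<in>B. \<exists>a\<in>A. R a b)"

text \<open>
  Fix a function \<open>u\<close> moving every \<open>a \<in> A\<close> up into \<open>B\<close>. The intermediate set is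
  \<open>X \<union> u ` (A - X)\<close> for some \<open>X \<subseteq> A\<close>: members of \<open>X\<close> stay where they are, the others move along
  \<open>u\<close>. Every \<open>b \<in> B\<close> must lie in \<open>u ` (A - X)\<close> or above a member of \<open>X\<close>, as is the case for
  \<open>X = A\<close>. Taking \<open>X\<close> minimal makes the map from \<open>B\<close> surjective: if \<open>x\<close> cannot be dropped from \<open>X\<close>, some
  \<open>b\<close> is above \<open>x\<close>, above no other member of \<open>X\<close>, and outside \<open>u ` (A - X)\<close>; this \<open>b\<close> has to be
  sent to \<open>x\<close>. In graph terms, the relation is thinned out to disjoint stars and the intermediate
  set consists of their centres.
\<close>

lemma egli_milner_interpolation:
  assumes fin: "finite A" and refl: "\<And>x. R x x" and EM: "egli_milner R A B"
  obtains h g where "\<And>a. a \<in> A \<Longrightarrow> R a (h a)" "\<And>b. b \<in> B \<Longrightarrow> R (g b) b"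
    "h ` A = g ` B" "h ` A \<subseteq> A \<union> B"
proof -
  obtain u where u: "\<And>a. a \<in> A \<Longrightarrow> u a \<in> B \<and> R a (u a)"
    using EM unfolding egli_milner_def by metis
  define covers where
    "covers X \<longleftrightarrow> X \<subseteq> A \<and> (\<forall>b\<in>B. b \<in> u ` (A - X) \<or> (\<exists>x\<in>X. R x b))" for X
  have "covers A" using EM by (auto simp: covers_def egli_milner_def)
  moreover have "finite {X. covers X}"
    using fin by (auto simp: covers_def intro: finite_subset[of _ "Pow A"])
  ultimately obtain X where X: "covers X" and min: "\<And>Y. covers Y \<Longrightarrow> Y \<subseteq> X \<Longrightarrow> Y = X"
    using finite_has_minimal[of "{X. covers X}"] by blast
  define h where "h a = (if a \<in> X then a else u a)" for a
  \<comment> \<open>A member of \<open>u ` (A - X)\<close> is sent to itself even if it is above a member of \<open>X\<close>, since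
    it may be the only point of \<open>B\<close> available to hit it.\<close>
  define g where "g b = (if b \<in> u ` (A - X) then b else (SOME x. x \<in> X \<and> R x b))" for b
  have g: "g b \<in> X \<and> R (g b) b" if "b \<in> B" "b \<notin> u ` (A - X)" for b
  proof -
    have "\<exists>x. x \<in> X \<and> R x b" using X that by (auto simp: covers_def)
    from someI_ex[OF this] show ?thesis using that(2) by (simp add: g_def)
  qed
  have hA: "h ` A = X \<union> u ` (A - X)"
    using X by (auto simp: h_def covers_def)
  \<comment> \<open>A point of \<open>B\<close> left uncovered by \<open>X - {x}\<close> must be sent to \<open>x\<close>.\<close>
  have "\<exists>b\<in>B. g b = x" if x: "x \<in> X" for x
  proof -
    have "\<not> covers (X - {x})" using min x by blast
    then obtain b where b: "b \<in> B" "b \<notin> u ` (A - (X - {x}))" "\<And>z. z \<in> X - {x} \<Longrightarrow> \<not> R z b"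
      using X by (auto simp: covers_def)
    then have "b \<notin> u ` (A - X)" by auto
    then show ?thesis using g b by blast
  qed
  moreover have "g b = b" if "b \<in> u ` (A - X)" for b
    using that by (simp add: g_def)
  ultimately have "X \<union> u ` (A - X) \<subseteq> g ` B"
    using u by (force simp: image_iff)
  moreover have "g ` B \<subseteq> X \<union> u ` (A - X)"
    using g by (auto simp: g_def)
  ultimately have eq: "h ` A = g ` B" unfolding hA by (rule subset_antisym)
  have h: "R a (h a)" if "a \<in> A" for a using that u refl by (simp add: h_def)
  have g': "R (g b) b" if "b \<in> B" for b
    using that g refl by (cases "b \<in> u ` (A - X)") (auto simp: g_def)
  have "h ` A \<subseteq> A \<union> B" using hA X u by (auto simp: covers_def)
  with h g' eq show ?thesis by (rule that)
qed

text \<open>The interpolating set is reached by enlarging the types in \<open>V\<close>, and left by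
  undoing a shrinking of the types in \<open>V'\<close>; only the second step changes the type of the world
  of evaluation.\<close>

lemma sat_types_egli_milner:
  assumes mono: "monotone_in (Log (D_frame k)) ps rs \<phi>"
    and vars: "vars \<phi> \<subseteq> set ps \<union> set rs" and dist: "distinct (ps @ rs)"
    and Q: "Q = set ps \<union> set rs"
    and t: "type_le (set ps) t t'" "t' \<subseteq> Q"
    and EM: "egli_milner (type_le (set ps)) (cluster_types k Q V) (cluster_types k Q V')"
    and sat: "sat_types k Q \<phi> t (cluster_types k Q V)"
  shows "sat_types k Q \<phi> t' (cluster_types k Q V')"
proof -
  let ?A = "cluster_types k Q V" and ?B = "cluster_types k Q V'"
  obtain h g where h: "\<And>a. a \<in> ?A \<Longrightarrow> type_le (set ps) a (h a)"
    and g: "\<And>b. b \<in> ?B \<Longrightarrow> type_le (set ps) (g b) b"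
    and hg: "h ` ?A = g ` ?B" and sub: "h ` ?A \<subseteq> ?A \<union> ?B"
  proof (rule egli_milner_interpolation[where R = "type_le (set ps)", OF _ type_le_refl EM])
    show "finite ?A" by (simp add: cluster_types_def)
  qed blast
  have Q_types: "a \<subseteq> Q" if "a \<in> ?A \<union> ?B" for a
    using that by (auto simp: cluster_types_def vtype_def)
  have tQ: "t \<subseteq> Q" using t by (auto simp: type_le_def)
  have "sat_types k Q \<phi> t ((\<lambda>i. h (vtype Q V i)) ` {..<k})"
  proof (rule sat_types_mono[OF mono vars dist Q type_le_refl tQ])
    show "sat_types k Q \<phi> t (vtype Q V ` {..<k})"
      using sat by (simp add: cluster_types_def)
    fix i assume "i < k"
    then have "vtype Q V i \<in> ?A" by (auto simp: cluster_types_def)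
    then show "type_le (set ps) (vtype Q V i) (h (vtype Q V i)) \<and> h (vtype Q V i) \<subseteq> Q"
      using h[of "vtype Q V i"] Q_types[of "h (vtype Q V i)"] sub by blast
  qed
  also have "(\<lambda>i. h (vtype Q V i)) ` {..<k} = (\<lambda>i. g (vtype Q V' i)) ` {..<k}"
    using hg by (simp add: cluster_types_def image_image)
  finally have *: "sat_types k Q \<phi> t ((\<lambda>i. g (vtype Q V' i)) ` {..<k})" .
  have "sat_types k Q \<phi> t' (vtype Q V' ` {..<k})"
  proof (rule sat_types_mono[OF mono vars dist Q t _ *])
    fix i assume "i < k"
    then have "vtype Q V' i \<in> ?B" by (auto simp: cluster_types_def)
    then show "type_le (set ps) (g (vtype Q V' i)) (vtype Q V' i) \<and> vtype Q V' i \<subseteq> Q"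
      using g[of "vtype Q V' i"] Q_types[of "vtype Q V' i"] by blast
  qed
  then show ?thesis by (simp add: cluster_types_def)
qed

section \<open>Positive descriptions of types\<close>

definition Conj :: "fm set \<Rightarrow> fm" where
  "Conj S = foldr And (SOME xs. set xs = S) Top"

definition Disj :: "fm set \<Rightarrow> fm" where
  "Disj S = foldr Or (SOME xs. set xs = S) Bot"

lemma some_list: "finite S \<Longrightarrow> set (SOME xs. set xs = S) = S"
  by (metis (mono_tags) finite_list someI_ex)

lemma
  assumes "finite S"
  shows sat_Conj: "sat F V w (Conj S) \<longleftrightarrow> (\<forall>\<psi>\<in>S. sat F V w \<psi>)"
    and lits_Conj: "lits (Conj S) = \<Union> (lits ` S)"
proof -
  have "sat F V w (foldr And xs Top) \<longleftrightarrow> (\<forall>\<psi>\<in>set xs. sat F V w \<psi>)"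
    "lits (foldr And xs Top) = \<Union> (lits ` set xs)" for xs
    by (induction xs) auto
  then show "sat F V w (Conj S) \<longleftrightarrow> (\<forall>\<psi>\<in>S. sat F V w \<psi>)" "lits (Conj S) = \<Union> (lits ` S)"
    by (simp_all add: Conj_def some_list[OF assms])
qed

lemma
  assumes "finite S"
  shows sat_Disj: "sat F V w (Disj S) \<longleftrightarrow> (\<exists>\<psi>\<in>S. sat F V w \<psi>)"
    and lits_Disj: "lits (Disj S) = \<Union> (lits ` S)"
proof -
  have "sat F V w (foldr Or xs Bot) \<longleftrightarrow> (\<exists>\<psi>\<in>set xs. sat F V w \<psi>)"
    "lits (foldr Or xs Bot) = \<Union> (lits ` set xs)" for xs
    by (induction xs) auto
  then show "sat F V w (Disj S) \<longleftrightarrow> (\<exists>\<psi>\<in>S. sat F V w \<psi>)" "lits (Disj S) = \<Union> (lits ` S)"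
    by (simp_all add: Disj_def some_list[OF assms])
qed

definition type_fm :: "nat set \<Rightarrow> nat set \<Rightarrow> fm" where
  "type_fm R t = Conj (Pos ` t \<union> Neg ` (R - t))"

text \<open>Omitting the negative literals over \<open>P\<close> turns the description of a single type into one
  of all types above it.\<close>

lemma sat_type_fm:
  assumes "finite P" "finite R" "P \<inter> R = {}" "t \<subseteq> P \<union> R"
  shows "sat F V w (type_fm R t) \<longleftrightarrow> type_le P t (vtype (P \<union> R) V w)"
proof -
  have "finite t" using assms finite_subset by blast
  then show ?thesis
    using assms by (auto simp: type_fm_def sat_Conj type_le_def vtype_def ball_Un)
qed

lemma lits_type_fm:
  "finite t \<Longrightarrow> finite R \<Longrightarrow> lits (type_fm R t) \<subseteq> Pos ` t \<union> Neg ` R"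
  by (auto simp: type_fm_def lits_Conj)

text \<open>The cluster is final and its worlds see exactly the cluster, so it can be quantified over
  from any world.\<close>

lemma sat_D_Box_Dia:
  assumes "w \<le> k" "k \<ge> 1"
  shows "sat (D_frame k) V w (Box (Dia \<phi>)) \<longleftrightarrow> (\<exists>u<k. sat (D_frame k) V u \<phi>)"
proof -
  have "0 < k" using assms by simp
  have "sat (D_frame k) V w (Box (Dia \<phi>)) \<longleftrightarrow>
      (sat (D_frame k) V w \<phi> \<or> (\<exists>u<k. sat (D_frame k) V u \<phi>)) \<and>
      (\<forall>v<k. sat (D_frame k) V v \<phi> \<or> (\<exists>u<k. sat (D_frame k) V u \<phi>))"
    using assms(1) sat_D_Dia[OF less_imp_le] by (simp add: sat_D_Box sat_D_Dia del: sat.simps(7,8))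
  then show ?thesis using \<open>0 < k\<close> by blast
qed

lemma sat_D_Dia_Box:
  assumes "w \<le> k" "k \<ge> 1"
  shows "sat (D_frame k) V w (Dia (Box \<phi>)) \<longleftrightarrow> (\<forall>u<k. sat (D_frame k) V u \<phi>)"
proof -
  have "0 < k" using assms by simp
  then show ?thesis
    using assms(1) by (simp only: sat_D_Box sat_D_Dia less_imp_le cong: conj_cong) metis
qed

definition types_fm :: "nat set \<Rightarrow> nat set \<Rightarrow> nat set set \<Rightarrow> fm" where
  "types_fm R t T =
     And (type_fm R t)
       (And (Conj ((\<lambda>x. Box (Dia (type_fm R x))) ` T)) (Dia (Box (Disj (type_fm R ` T)))))"

text \<open>The two modal conjuncts of \<open>types_fm\<close> are the two halves of the Egli-Milner order.\<close>

lemma sat_types_fm: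
  assumes fin: "finite P" "finite R" and disj: "P \<inter> R = {}" and k: "k \<ge> 1" and w: "w \<le> k"
    and t: "t \<subseteq> P \<union> R" and T: "T \<subseteq> Pow (P \<union> R)"
  shows "sat (D_frame k) V w (types_fm R t T) \<longleftrightarrow>
    type_le P t (vtype (P \<union> R) V w) \<and>
    egli_milner (type_le P) T (cluster_types k (P \<union> R) V)"
proof -
  have finT: "finite T" using T fin finite_subset by blast
  have x: "sat (D_frame k) V u (type_fm R x) \<longleftrightarrow> type_le P x (vtype (P \<union> R) V u)"
    if "x \<in> T" for x u
  proof (rule sat_type_fm[OF fin disj])
    show "x \<subseteq> P \<union> R" using that T by blast
  qed
  have lower: "sat (D_frame k) V w (Conj ((\<lambda>x. Box (Dia (type_fm R x))) ` T)) \<longleftrightarrow>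
      (\<forall>x\<in>T. \<exists>b\<in>cluster_types k (P \<union> R) V. type_le P x b)"
    using finT x by (simp add: sat_Conj sat_D_Box_Dia[OF w k] cluster_types_def Bex_def
        del: sat.simps(7,8))
  have upper: "sat (D_frame k) V w (Dia (Box (Disj (type_fm R ` T)))) \<longleftrightarrow>
      (\<forall>b\<in>cluster_types k (P \<union> R) V. \<exists>x\<in>T. type_le P x b)"
    using finT x by (auto simp: sat_Disj sat_D_Dia_Box[OF w k] cluster_types_def
        simp del: sat.simps(7,8))
  show ?thesis
    unfolding types_fm_def egli_milner_def
    using sat_type_fm[OF fin disj t, of "D_frame k" V w] lower upper by (simp del: sat.simps(7,8))
qed

lemma lits_types_fm:
  assumes fin: "finite P" "finite R" and t: "t \<subseteq> P \<union> R" and T: "T \<subseteq> Pow (P \<union> R)"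
  shows "lits (types_fm R t T) \<subseteq> Pos ` (P \<union> R) \<union> Neg ` R"
proof -
  have "lits (type_fm R x) \<subseteq> Pos ` (P \<union> R) \<union> Neg ` R" if "x \<subseteq> P \<union> R" for x
    using lits_type_fm[of x R] fin that finite_subset[OF that] by blast
  moreover have "finite T" using T fin finite_subset by blast
  ultimately show ?thesis
    using t T by (simp add: types_fm_def lits_Conj lits_Disj) blast
qed

section \<open>The Lyndon positivity property\<close>

theorem proposition4p16:
  fixes k :: nat
  assumes "k \<ge> 1"
  shows "LPP (Log (D_frame k))"
  unfolding LPP_def
proof (intro conjI allI impI monotone_logic_Log)
  fix ps rs \<phi>
  assume "distinct (ps @ rs) \<and> vars \<phi> \<subseteq> set ps \<union> set rs \<and> monotone_in (Log (D_frame k)) ps rs \<phi>"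
  then have dist: "distinct (ps @ rs)" and vars: "vars \<phi> \<subseteq> set ps \<union> set rs"
    and mono: "monotone_in (Log (D_frame k)) ps rs \<phi>" by auto
  define Q where "Q = set ps \<union> set rs"
  define S where "S = {(t, T). t \<subseteq> Q \<and> T \<subseteq> Pow Q \<and> sat_types k Q \<phi> t T}"
  define \<alpha> where "\<alpha> = Disj ((\<lambda>(t, T). types_fm (set rs) t T) ` S)"
  have "S \<subseteq> Pow Q \<times> Pow (Pow Q)" by (auto simp: S_def)
  then have finS: "finite S" by (rule finite_subset) (simp add: Q_def)
  have disj: "set ps \<inter> set rs = {}" using dist by auto
  have lits: "lits \<alpha> \<subseteq> Pos ` Q \<union> Neg ` set rs"
  proof -
    have "lits (types_fm (set rs) t T) \<subseteq> Pos ` Q \<union> Neg ` set rs" if "(t, T) \<in> S" for t T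
      using lits_types_fm[of "set ps" "set rs" t T] that by (simp add: S_def Q_def)
    then show ?thesis
      unfolding \<alpha>_def lits_Disj[OF finite_imageI[OF finS]] by (simp add: UN_subset_iff split_beta)
  qed
  have "sat (D_frame k) V w \<phi> \<longleftrightarrow> sat (D_frame k) V w \<alpha>" if w: "w \<le> k" for V w
  proof -
    let ?t = "vtype Q V w" and ?T = "cluster_types k Q V"
    have tQ: "?t \<subseteq> Q" "?T \<subseteq> Pow Q" by (auto simp: cluster_types_def vtype_def)
    have desc: "sat (D_frame k) V w (types_fm (set rs) t T) \<longleftrightarrow>
        type_le (set ps) t ?t \<and> egli_milner (type_le (set ps)) T ?T"
      if "t \<subseteq> Q" "T \<subseteq> Pow Q" for t T
      using sat_types_fm[OF _ _ disj assms w] that by (simp add: Q_def)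
    have sat_\<alpha>: "sat (D_frame k) V w \<alpha> \<longleftrightarrow>
        (\<exists>(t, T)\<in>S. type_le (set ps) t ?t \<and> egli_milner (type_le (set ps)) T ?T)"
    proof -
      have "sat (D_frame k) V w \<alpha> \<longleftrightarrow>
          (\<exists>(t, T)\<in>S. sat (D_frame k) V w (types_fm (set rs) t T))"
        by (simp add: \<alpha>_def sat_Disj[OF finite_imageI[OF finS]] split_beta)
      also have "\<dots> \<longleftrightarrow> (\<exists>(t, T)\<in>S. type_le (set ps) t ?t \<and> egli_milner (type_le (set ps)) T ?T)"
        by (rule bex_cong) (auto simp: S_def desc)
      finally show ?thesis .
    qed
    show ?thesis
    proof
      assume "sat (D_frame k) V w \<phi>"
      then have "(?t, ?T) \<in> S"
        using sat_types_vtype[of \<phi> Q w k V] vars w tQ by (simp add: S_def Q_def)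
      moreover have "egli_milner (type_le (set ps)) ?T ?T"
        using type_le_refl by (auto simp: egli_milner_def)
      ultimately show "sat (D_frame k) V w \<alpha>"
        using sat_\<alpha> type_le_refl by blast
    next
      assume "sat (D_frame k) V w \<alpha>"
      then obtain t T where S: "sat_types k Q \<phi> t T"
        and le: "type_le (set ps) t ?t" "egli_milner (type_le (set ps)) T ?T"
        using sat_\<alpha> by (auto simp: S_def)
      from S obtain V\<^sub>0 where "T = cluster_types k Q V\<^sub>0" by (auto simp: sat_types_def)
      then have "sat_types k Q \<phi> ?t ?T"
        using sat_types_egli_milner[OF mono vars dist Q_def le(1) tQ(1)] le(2) S by simp
      then show "sat (D_frame k) V w \<phi>"
        using sat_types_vtype[of \<phi> Q w k V] vars w by (simp add: Q_def)
    qed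
  qed
  then have "Iff \<phi> \<alpha> \<in> Log (D_frame k)" by (simp add: Log_def sat_Iff)
  moreover have "vars \<alpha> \<subseteq> set ps \<union> set rs" "positive_in ps \<alpha>"
    using lits disj by (auto simp: vars_def positive_in_def Q_def)
  ultimately show "\<exists>\<alpha>. vars \<alpha> \<subseteq> set ps \<union> set rs \<and> positive_in ps \<alpha> \<and> Iff \<phi> \<alpha> \<in> Log (D_frame k)"
    by blast
qed

end
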